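(* There exists a continuous map $H:\mathcal M(\mathcal I)\times[0,1]\to\mathcal M(\mathcal I)$ such that (1) for each $m\in\mathcal M(\mathcal I)$, $H(m,0)=m$ and $H(m,1)=0$ (the null measure); (2) for all $\varepsilon\in(0,1]$ and $m\in\mathcal M(\mathcal I)$, $H(m,\varepsilon)\in\mathcal M_{\mathrm{loc}}(\mathcal I)$.
   Context: $\mathcal I=(\alpha,\beta)\subset\mathbb R$ is an open interval, $-\infty\le\alpha<\beta\le\infty$, with Borel $\sigma$-field $\mathcal B(\mathcal I)$. $\mathcal M(\mathcal I)$ is the set of nonnegative, regular, not necessarily finite (nor locally finite) measures $m:\mathcal B(\mathcal I)\to[0,\infty]$, where regular means that for every $A\in\mathcal B(\mathcal I)$, $m(A)=\inf\{m(O):A\subset O,\ O\text{ open}\}=\sup\{m(K):K\subset A,\ K\text{ compact}\}$. $\mathcal M_{\mathrm{loc}}(\mathcal I)\subset\mathcal M(\mathcal I)$ is the subset of locally finite measures. $\mathcal M(\mathcal I)$ is endowed with the topology $\vartheta$, the coarsest topology such that $m\mapsto m((a,b))\in[0,\infty]$ is lower semicontinuous for all $a,b\in\mathcal I\cap\mathbb Q$ with $a<b$, and $m\mapsto m([a,b])\in[0,\infty]$ is upper semicontinuous for all $a,b\in\mathcal I\cap\mathbb Q$ with $a\le b$; $\mathcal M(\mathcal I)\times[0,1]$ carries the product topology. *)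

theory Defs
  imports "HOL-Analysis.Analysis"
begin

text \<open>
  The Borel sets of \<open>I\<close> are \<open>sets (restrict_space borel I)\<close>.  A value of type \<open>real measure\<close> is
  determined by its \<open>\<sigma>\<close>-algebra and its \<open>[0,\<infinity>]\<close>-valued set function, so equality in
  \<open>measures_on I\<close> is equality of measures.  Since \<^const>\<open>emeasure\<close> is \<open>0\<close> outside
  the \<open>\<sigma>\<close>-algebra, it matters that the open sets and the intervals below are subsets of \<open>I\<close>;
  \<open>I\<close> is an open interval throughout.
\<close>

definition regular_on :: "real set \<Rightarrow> real measure \<Rightarrow> bool" where
  "regular_on I m \<longleftrightarrow>
     (\<forall>A \<in> sets (restrict_space borel I).
        emeasure m A = (INF U \<in> {U. openin (top_of_set I) U \<and> A \<subseteq> U}. emeasure m U) \<and>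
        emeasure m A = (SUP K \<in> {K. compact K \<and> K \<subseteq> A}. emeasure m K))"

definition measures_on :: "real set \<Rightarrow> real measure set" where
  "measures_on I = {m. sets m = sets (restrict_space borel I) \<and> regular_on I m}"

definition locally_finite_on :: "real set \<Rightarrow> real measure \<Rightarrow> bool" where
  "locally_finite_on I m \<longleftrightarrow>
     (\<forall>x \<in> I. \<exists>U. openin (top_of_set I) U \<and> x \<in> U \<and> emeasure m U < \<infinity>)"

definition loc_measures_on :: "real set \<Rightarrow> real measure set" where
  "loc_measures_on I = {m \<in> measures_on I. locally_finite_on I m}"

definition lower_semicontinuous_map :: "'a topology \<Rightarrow> ('a \<Rightarrow> ennreal) \<Rightarrow> bool" where
  "lower_semicontinuous_map X f \<longleftrightarrow> (\<forall>c. openin X {x \<in> topspace X. c < f x})"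

definition upper_semicontinuous_map :: "'a topology \<Rightarrow> ('a \<Rightarrow> ennreal) \<Rightarrow> bool" where
  "upper_semicontinuous_map X f \<longleftrightarrow> (\<forall>c. openin X {x \<in> topspace X. f x < c})"

definition interval_semicontinuous :: "real set \<Rightarrow> real measure topology \<Rightarrow> bool" where
  "interval_semicontinuous I X \<longleftrightarrow>
     (\<forall>a \<in> I \<inter> \<rat>. \<forall>b \<in> I \<inter> \<rat>. a < b \<longrightarrow>
        lower_semicontinuous_map X (\<lambda>m. emeasure m {a<..<b})) \<and>
     (\<forall>a \<in> I \<inter> \<rat>. \<forall>b \<in> I \<inter> \<rat>. a \<le> b \<longrightarrow>
        upper_semicontinuous_map X (\<lambda>m. emeasure m {a..b}))"

text \<open>
  The topology \<open>\<vartheta>\<close>, given by a subbase; the lemmas below show that it is the coarsest topology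
  on \<open>measures_on I\<close> satisfying \<open>interval_semicontinuous I\<close>.
\<close>

definition theta_topology :: "real set \<Rightarrow> real measure topology" where
  "theta_topology I = topology_generated_by
     ({measures_on I} \<union>
      {{m \<in> measures_on I. c < emeasure m {a<..<b}} | a b c. a \<in> I \<inter> \<rat> \<and> b \<in> I \<inter> \<rat> \<and> a < b} \<union>
      {{m \<in> measures_on I. emeasure m {a..b} < c} | a b c. a \<in> I \<inter> \<rat> \<and> b \<in> I \<inter> \<rat> \<and> a \<le> b})"

lemma topspace_theta_topology [simp]: "topspace (theta_topology I) = measures_on I"
  unfolding theta_topology_def topology_generated_by_topspace by blast

lemma interval_semicontinuous_theta_topology: "interval_semicontinuous I (theta_topology I)"
  unfolding interval_semicontinuous_def lower_semicontinuous_map_def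
    upper_semicontinuous_map_def topspace_theta_topology
  unfolding theta_topology_def
  by (intro conjI ballI allI impI topology_generated_by_Basis) blast+

lemma theta_topology_coarsest:
  assumes "topspace X = measures_on I" "interval_semicontinuous I X" "openin (theta_topology I) V"
  shows "openin X V"
proof -
  have "openin X (measures_on I)"
    using assms(1) openin_topspace[of X] by simp
  then have sub: "openin X U"
    if "U \<in> {measures_on I} \<union>
      {{m \<in> measures_on I. c < emeasure m {a<..<b}} | a b c. a \<in> I \<inter> \<rat> \<and> b \<in> I \<inter> \<rat> \<and> a < b} \<union>
      {{m \<in> measures_on I. emeasure m {a..b} < c} | a b c. a \<in> I \<inter> \<rat> \<and> b \<in> I \<inter> \<rat> \<and> a \<le> b}"
    for U
    using that assms(2) unfolding interval_semicontinuous_def lower_semicontinuous_map_def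
      upper_semicontinuous_map_def assms(1)
    by blast
  show ?thesis
    using openin_topology_generated_by[OF assms(3)[unfolded theta_topology_def]]
  proof (induction rule: generate_topology_on.induct)
    case (Basis s)
    then show ?case by (rule sub)
  qed (blast intro: openin_empty openin_Int openin_Union)+
qed

end

theory Submission
  imports Defs
begin

text \<open>
  The deformation smears \<open>m\<close> over windows of radius \<open>\<epsilon>\<close> and truncates: \<open>H(m,0) = m\<close>, and for
  \<open>0 < \<epsilon> \<le> 1\<close> the measure \<open>H(m,\<epsilon>)\<close> on \<open>I\<close> has the Lebesgue density
  \<open>(1 - \<epsilon>) / (2 \<epsilon>) * min (m (x - \<epsilon>, x + \<epsilon>)) (1 / \<epsilon>)\<close>
  at those \<open>x\<close> with \<open>x - \<epsilon>, x + \<epsilon> \<in> I\<close> and \<open>\<bar>x\<bar> < 1 / \<epsilon>\<close>, and density \<open>0\<close> at all other \<open>x\<close>.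
  The density is bounded and vanishes off a bounded set, so \<open>H(m,\<epsilon>)\<close> is finite, hence regular and
  locally finite; the factor \<open>1 - \<epsilon>\<close> makes \<open>H(m,1) = 0\<close>.

  Each point of \<open>\<M>(I)\<close> has a countable family of neighbourhoods that decides convergence on the
  intervals of the subbase of \<open>\<vartheta>\<close>, so continuity of \<open>H\<close> may be tested along sequences
  \<open>m\<^sub>n \<rightarrow> m\<close>, \<open>\<epsilon>\<^sub>n \<rightarrow> \<epsilon>\<close> (\<open>openin_prod_theta_sequentially\<close>).  Regularity upgrades the two
  semicontinuity conditions from fixed rational intervals to intervals with convergent real end
  points (\<open>theta_tendsto_Ioo\<close>, \<open>theta_tendsto_Icc\<close>).

  If \<open>\<epsilon> > 0\<close>, the densities converge at every \<open>x\<close> for which the open and the closed window have the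
  same \<open>m\<close>-measure, apart from finitely many \<open>x\<close> tied to the ends of \<open>I\<close> and to the cutoff
  \<open>\<bar>x\<bar> < 1 / \<epsilon>\<close>.  The exceptional \<open>x\<close> are countable in number (\<open>countable_Icc_neq_Ioo\<close>), although
  \<open>m\<close> itself may have uncountably many atoms: where the open window has infinite mass the two windows
  agree.  Dominated convergence then gives convergence on every Borel set.

  If \<open>\<epsilon> = 0\<close>, Fubini's theorem shows that smearing moves mass by at most \<open>\<epsilon>\<^sub>n\<close> without increasing it,
  which gives the bound on closed intervals (\<open>emeasure_smooth_le\<close>).  For the bound on open intervals the
  truncation must be controlled (\<open>emeasure_smooth_ge\<close>): for small \<open>\<epsilon>\<close>, the interval \<open>(p - \<epsilon>, q + \<epsilon>)\<close>
  keeps mass at least \<open>(1 - \<epsilon>) * min (m (p,q)) (1 / \<epsilon>)\<close>, which tends to \<open>m (p,q)\<close> as \<open>\<epsilon> \<rightarrow> 0\<close>, also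
  when that mass is infinite.
\<close>

section \<open>Auxiliary facts\<close>

text \<open>
  The gaps \<open>(h a, k a)\<close> are nonempty and pairwise disjoint, so they contain distinct rationals.
\<close>

lemma countable_if_disjoint_ennreal_gaps:
  fixes h k :: "real \<Rightarrow> ennreal"
  assumes "\<And>a. a \<in> S \<Longrightarrow> h a < k a"
    and "\<And>a b. a \<in> S \<Longrightarrow> b \<in> S \<Longrightarrow> a < b \<Longrightarrow> k b \<le> h a \<or> k a \<le> h b"
  shows "countable S"
proof -
  have "\<forall>a\<in>S. \<exists>r::rat. h a < real_of_rat r \<and> real_of_rat r < k a"
    using ennreal_rat_dense[OF assms(1)] by blast
  then obtain r :: "real \<Rightarrow> rat"
    where r: "\<And>a. a \<in> S \<Longrightarrow> h a < real_of_rat (r a)" "\<And>a. a \<in> S \<Longrightarrow> real_of_rat (r a) < k a"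
    by metis
  have neq: "r a \<noteq> r b" if "a \<in> S" "b \<in> S" "a < b" for a b
    using assms(2)[OF that] r[OF that(1)] r[OF that(2)] by (metis leD less_trans not_le_imp_less)
  have "inj_on r S"
    by (rule inj_onI) (metis neq linorder_neqE_linordered_idom)
  then show ?thesis
    by (rule countable_image_inj_on[rotated]) simp
qed

lemma nn_integral_dominating_finite:
  "(\<integral>\<^sup>+x. ennreal c * indicator {a..b::real} x \<partial>lborel) < \<infinity>"
  by (simp add: nn_integral_cmult_indicator ennreal_mult_less_top emeasure_lborel_Icc_eq)

text \<open>
  The interval is fixed together with its end points, which are needed to see that only finitely many
  points of the closure of \<open>I\<close> are missing from \<open>I\<close>.
\<close>

locale open_interval =
  fixes I :: "real set" and \<alpha> \<beta> :: ereal
  assumes I_eq: "I = einterval \<alpha> \<beta>"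
begin

lemma open_I: "open I"
  by (simp add: I_eq)

lemma Icc_subset: "a \<in> I \<Longrightarrow> b \<in> I \<Longrightarrow> {a..b} \<subseteq> I"
  unfolding I_eq einterval_iff subset_iff atLeastAtMost_iff
  by (meson ereal_less_eq(3) less_le_trans le_less_trans)

lemma Ioo_subset: "a \<in> I \<Longrightarrow> b \<in> I \<Longrightarrow> {a<..<b} \<subseteq> I"
  using Icc_subset[of a b] by force

lemma sets_measures_on:
  assumes "m \<in> measures_on I"
  shows "A \<in> sets m \<longleftrightarrow> A \<subseteq> I \<and> A \<in> sets borel"
  using assms open_I by (simp add: measures_on_def sets_restrict_space_iff)

lemma space_measures_on: "m \<in> measures_on I \<Longrightarrow> space m = I"
  using sets_eq_imp_space_eq[of m "restrict_space borel I"]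
  by (simp add: measures_on_def space_restrict_space)

lemma emeasure_mono_I:
  assumes "m \<in> measures_on I" "A \<subseteq> B" "B \<subseteq> I" "B \<in> sets borel"
  shows "emeasure m A \<le> emeasure m B"
  using assms by (intro emeasure_mono) (auto simp: sets_measures_on)

section \<open>Regular measures on rational intervals\<close>

lemma less_emeasure_Ioo_imp_rational:
  assumes m: "m \<in> measures_on I" and I: "a \<in> I" "b \<in> I" and c: "c < emeasure m {a<..<b}"
  obtains p q where "p \<in> \<rat>" "q \<in> \<rat>" "a < p" "p < q" "q < b" "c < emeasure m {p<..<q}"
proof -
  have sub: "{a<..<b} \<subseteq> I"
    using I by (rule Ioo_subset)
  have "{a<..<b} \<in> sets (restrict_space borel I)"
    using sub open_I by (simp add: sets_restrict_space_iff)
  then have "emeasure m {a<..<b} = (SUP K \<in> {K. compact K \<and> K \<subseteq> {a<..<b}}. emeasure m K)"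
    using m unfolding measures_on_def regular_on_def by blast
  with c obtain K where K: "compact K" "K \<subseteq> {a<..<b}" "c < emeasure m K"
    by (auto simp: less_SUP_iff)
  have "K \<noteq> {}"
    using K(3) by auto
  then obtain s t where st: "s \<in> K" "t \<in> K" "\<And>x. x \<in> K \<Longrightarrow> s \<le> x \<and> x \<le> t"
    using compact_attains_inf[OF K(1)] compact_attains_sup[OF K(1)] by metis
  have "a < s" "t < b" "s \<le> t"
    using st K(2) by auto
  obtain p where p: "p \<in> \<rat>" "a < p" "p < s"
    using Rats_dense_in_real[OF \<open>a < s\<close>] by blast
  obtain q where q: "q \<in> \<rat>" "t < q" "q < b"
    using Rats_dense_in_real[OF \<open>t < b\<close>] by blast
  have "{p<..<q} \<subseteq> I"
    using sub p q by auto
  moreover have "K \<subseteq> {p<..<q}"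
    using st(3) p q by fastforce
  ultimately have "emeasure m K \<le> emeasure m {p<..<q}"
    by (intro emeasure_mono_I[OF m]) auto
  with K(3) have "c < emeasure m {p<..<q}"
    by (rule less_le_trans)
  then show ?thesis
    using that p q \<open>s \<le> t\<close> by force
qed

lemma emeasure_Icc_less_imp_rational:
  assumes m: "m \<in> measures_on I" and I: "a \<in> I" "b \<in> I" and ab: "a \<le> b"
    and c: "emeasure m {a..b} < c"
  obtains p q where "p \<in> \<rat>" "q \<in> \<rat>" "p \<in> I" "q \<in> I" "p < a" "b < q" "emeasure m {p..q} < c"
proof -
  have sub: "{a..b} \<subseteq> I"
    using I by (rule Icc_subset)
  have "{a..b} \<in> sets (restrict_space borel I)"
    using sub open_I by (simp add: sets_restrict_space_iff)
  then have "emeasure m {a..b} = (INF U \<in> {U. openin (top_of_set I) U \<and> {a..b} \<subseteq> U}. emeasure m U)"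
    using m unfolding measures_on_def regular_on_def by blast
  with c obtain U where U: "openin (top_of_set I) U" "{a..b} \<subseteq> U" "emeasure m U < c"
    by (auto simp: INF_less_iff)
  have "open U" "U \<subseteq> I"
    using U(1) open_I by (auto simp: openin_open_eq)
  have "a \<in> U" "b \<in> U"
    using U(2) ab by auto
  obtain d where d: "d > 0" "ball a d \<subseteq> U"
    using \<open>open U\<close> \<open>a \<in> U\<close> openE by blast
  obtain e where e: "e > 0" "ball b e \<subseteq> U"
    using \<open>open U\<close> \<open>b \<in> U\<close> openE by blast
  obtain p where p: "p \<in> \<rat>" "a - d < p" "p < a"
    using Rats_dense_in_real[of "a - d" a] d by auto
  obtain q where q: "q \<in> \<rat>" "b < q" "q < b + e"
    using Rats_dense_in_real[of b "b + e"] e by auto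
  have "{p..q} \<subseteq> ball a d \<union> {a..b} \<union> ball b e"
    using p q by (auto simp: ball_def dist_real_def)
  then have pq: "{p..q} \<subseteq> U"
    using d e U(2) by blast
  have "emeasure m {p..q} \<le> emeasure m U"
    using pq \<open>open U\<close> \<open>U \<subseteq> I\<close> by (intro emeasure_mono_I[OF m]) auto
  with U(3) have "emeasure m {p..q} < c" by simp
  moreover have "p \<in> I" "q \<in> I"
    using subsetD[OF pq, of p] subsetD[OF pq, of q] p q ab \<open>U \<subseteq> I\<close> by auto
  ultimately show ?thesis
    using that p q by blast
qed

section \<open>Sequential convergence\<close>

text \<open>
  Convergence of a sequence in \<open>\<vartheta>\<close>, spelled out as the two semicontinuity conditions on
  the intervals of the subbase.
\<close>

definition theta_tendsto :: "(nat \<Rightarrow> real measure) \<Rightarrow> real measure \<Rightarrow> bool" where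
  "theta_tendsto \<mu> m \<longleftrightarrow>
     (\<forall>a \<in> I \<inter> \<rat>. \<forall>b \<in> I \<inter> \<rat>. a < b \<longrightarrow>
        (\<forall>c < emeasure m {a<..<b}. \<forall>\<^sub>F n in sequentially. c < emeasure (\<mu> n) {a<..<b})) \<and>
     (\<forall>a \<in> I \<inter> \<rat>. \<forall>b \<in> I \<inter> \<rat>. a \<le> b \<longrightarrow>
        (\<forall>c > emeasure m {a..b}. \<forall>\<^sub>F n in sequentially. emeasure (\<mu> n) {a..b} < c))"

lemma eventually_in_I: "u \<longlonglongrightarrow> a \<Longrightarrow> a \<in> I \<Longrightarrow> \<forall>\<^sub>F n in sequentially. u n \<in> I"
  by (rule topological_tendstoD[OF _ open_I])

lemma theta_tendsto_Ioo:
  assumes "theta_tendsto \<mu> m" "m \<in> measures_on I" "\<And>n. \<mu> n \<in> measures_on I"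
    and "u \<longlonglongrightarrow> a" "v \<longlonglongrightarrow> b" "a \<in> I" "b \<in> I" "c < emeasure m {a<..<b}"
  shows "\<forall>\<^sub>F n in sequentially. c < emeasure (\<mu> n) {u n<..<v n}"
proof -
  obtain p q where pq: "p \<in> \<rat>" "q \<in> \<rat>" "a < p" "p < q" "q < b" "c < emeasure m {p<..<q}"
    using less_emeasure_Ioo_imp_rational assms(2,6-8) by blast
  have "p \<in> {a..b}" "q \<in> {a..b}"
    using pq by auto
  then have "p \<in> I" "q \<in> I"
    using Icc_subset[OF assms(6,7)] by auto
  then have "\<forall>\<^sub>F n in sequentially. c < emeasure (\<mu> n) {p<..<q}"
    using assms(1) pq unfolding theta_tendsto_def by blast
  moreover have "\<forall>\<^sub>F n in sequentially. u n < p" "\<forall>\<^sub>F n in sequentially. q < v n"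
    using order_tendstoD assms(4,5) pq by blast+
  moreover have "\<forall>\<^sub>F n in sequentially. u n \<in> I" "\<forall>\<^sub>F n in sequentially. v n \<in> I"
    using eventually_in_I assms by blast+
  ultimately show ?thesis
  proof eventually_elim
    case (elim n)
    have "emeasure (\<mu> n) {p<..<q} \<le> emeasure (\<mu> n) {u n<..<v n}"
      using elim Ioo_subset[of "u n" "v n"] by (intro emeasure_mono_I[OF assms(3)]) auto
    with elim(1) show ?case by (rule less_le_trans)
  qed
qed

lemma theta_tendsto_Icc:
  assumes "theta_tendsto \<mu> m" "m \<in> measures_on I" "\<And>n. \<mu> n \<in> measures_on I"
    and "u \<longlonglongrightarrow> a" "v \<longlonglongrightarrow> b" "a \<in> I" "b \<in> I" "a \<le> b" "emeasure m {a..b} < c"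
  shows "\<forall>\<^sub>F n in sequentially. emeasure (\<mu> n) {u n..v n} < c"
proof -
  obtain p q where pq: "p \<in> \<rat>" "q \<in> \<rat>" "p \<in> I" "q \<in> I" "p < a" "b < q" "emeasure m {p..q} < c"
    using emeasure_Icc_less_imp_rational assms(2,6-9) by blast
  then have "\<forall>\<^sub>F n in sequentially. emeasure (\<mu> n) {p..q} < c"
    using assms(1,8) unfolding theta_tendsto_def by auto
  moreover have "\<forall>\<^sub>F n in sequentially. p < u n" "\<forall>\<^sub>F n in sequentially. v n < q"
    using order_tendstoD assms(4,5) pq by blast+
  ultimately show ?thesis
  proof eventually_elim
    case (elim n)
    have "emeasure (\<mu> n) {u n..v n} \<le> emeasure (\<mu> n) {p..q}"
      using elim Icc_subset[OF pq(3,4)] by (intro emeasure_mono_I[OF assms(3)]) auto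
    with elim(1) show ?case by simp
  qed
qed

section \<open>Windows whose end points carry mass\<close>

text \<open>
  The atoms of \<open>m\<close> need not be countable in number, but those with finite mass immediately to their
  right are: for such atoms \<open>a < q\<close>, the intervals of values from \<open>m (a,q)\<close> to \<open>m [a,q)\<close> do not overlap.
\<close>

lemma countable_left_atoms:
  assumes m: "m \<in> measures_on I" and q: "q \<in> I"
  shows "countable {a \<in> I. a < q \<and> emeasure m {a} > 0 \<and> emeasure m {a<..<q} < \<infinity>}" (is "countable ?S")
proof (rule countable_if_disjoint_ennreal_gaps)
  fix a assume a: "a \<in> ?S"
  have eq: "{a..<q} = {a} \<union> {a<..<q}"
    using a by auto
  have "emeasure m {a..<q} = emeasure m {a} + emeasure m {a<..<q}"
    unfolding eq using a q Ioo_subset[of a q] 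
    by (intro plus_emeasure[symmetric]) (auto simp: sets_measures_on[OF m])
  with a show "emeasure m {a<..<q} < emeasure m {a..<q}"
    using ennreal_add_left_cancel_less[of "emeasure m {a<..<q}" 0 "emeasure m {a}"]
    by (auto simp: add.commute)
next
  fix a b assume "a \<in> ?S" "b \<in> ?S" "a < b"
  then have "emeasure m {b..<q} \<le> emeasure m {a<..<q}"
    using q Ioo_subset[of a q] by (intro emeasure_mono_I[OF m]) auto
  then show "emeasure m {b..<q} \<le> emeasure m {a<..<q} \<or> emeasure m {a..<q} \<le> emeasure m {b<..<q}" ..
qed

lemma countable_right_atoms:
  assumes m: "m \<in> measures_on I" and q: "q \<in> I"
  shows "countable {b \<in> I. q < b \<and> emeasure m {b} > 0 \<and> emeasure m {q<..<b} < \<infinity>}" (is "countable ?S")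
proof (rule countable_if_disjoint_ennreal_gaps)
  fix b assume b: "b \<in> ?S"
  have eq: "{q<..b} = {b} \<union> {q<..<b}"
    using b by auto
  have "emeasure m {q<..b} = emeasure m {b} + emeasure m {q<..<b}"
    unfolding eq using b q Ioo_subset[of q b] 
    by (intro plus_emeasure[symmetric]) (auto simp: sets_measures_on[OF m])
  with b show "emeasure m {q<..<b} < emeasure m {q<..b}"
    using ennreal_add_left_cancel_less[of "emeasure m {q<..<b}" 0 "emeasure m {b}"]
    by (auto simp: add.commute)
next
  fix a b assume "a \<in> ?S" "b \<in> ?S" "a < b"
  then have "emeasure m {q<..a} \<le> emeasure m {q<..<b}"
    using q Ioo_subset[of q b] by (intro emeasure_mono_I[OF m]) auto
  then show "emeasure m {q<..b} \<le> emeasure m {q<..<a} \<or> emeasure m {q<..a} \<le> emeasure m {q<..<b}" ..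
qed

lemma countable_Icc_neq_Ioo:
  assumes m: "m \<in> measures_on I" and e: "\<epsilon> > 0"
  shows "countable {x. x - \<epsilon> \<in> I \<and> x + \<epsilon> \<in> I \<and>
           emeasure m {x - \<epsilon>..x + \<epsilon>} \<noteq> emeasure m {x - \<epsilon><..<x + \<epsilon>}}" (is "countable ?N")
proof -
  define L where "L q = {a \<in> I. a < q \<and> emeasure m {a} > 0 \<and> emeasure m {a<..<q} < \<infinity>}" for q
  define R where "R q = {b \<in> I. q < b \<and> emeasure m {b} > 0 \<and> emeasure m {q<..<b} < \<infinity>}" for q
  have "?N \<subseteq> (\<Union>q\<in>\<rat> \<inter> I. (\<lambda>a. a + \<epsilon>) ` L q \<union> (\<lambda>b. b - \<epsilon>) ` R q)"
  proof
    fix x assume x: "x \<in> ?N"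
    let ?a = "x - \<epsilon>" and ?b = "x + \<epsilon>"
    have ab: "?a \<in> I" "?b \<in> I"
      using x by auto
    note sub = Icc_subset[OF ab]
    obtain q where q: "q \<in> \<rat>" "?a < q" "q < ?b"
      using Rats_dense_in_real[of ?a ?b] e by auto
    have qI: "q \<in> I"
      using sub q by auto
    have eq: "{?a..?b} = {?a} \<union> ({?a<..<?b} \<union> {?b})"
      using e by auto
    have add: "emeasure m {?a..?b} = emeasure m {?a} + (emeasure m {?a<..<?b} + emeasure m {?b})"
      unfolding eq using ab sub e
      by (subst plus_emeasure[symmetric]; (subst plus_emeasure[symmetric])?)
         (auto simp: sets_measures_on[OF m])
    have fin: "emeasure m {?a<..<?b} < \<infinity>"
      using x add by (cases "emeasure m {?a<..<?b} = \<infinity>") (auto simp: less_top)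
    have "emeasure m {?a<..<q} \<le> emeasure m {?a<..<?b}" "emeasure m {q<..<?b} \<le> emeasure m {?a<..<?b}"
      using q sub by (auto intro!: emeasure_mono_I[OF m])
    then have fins: "emeasure m {?a<..<q} < \<infinity>" "emeasure m {q<..<?b} < \<infinity>"
      using fin by auto
    have "emeasure m {?a} > 0 \<or> emeasure m {?b} > 0"
      using x add by (auto simp: zero_less_iff_neq_zero)
    then have "?a \<in> L q \<or> ?b \<in> R q"
      using ab q fins by (auto simp: L_def R_def)
    then have "x \<in> (\<lambda>a. a + \<epsilon>) ` L q \<union> (\<lambda>b. b - \<epsilon>) ` R q"
      by (auto simp: image_iff intro: bexI[of _ ?a] bexI[of _ ?b])
    then show "x \<in> (\<Union>q\<in>\<rat> \<inter> I. (\<lambda>a. a + \<epsilon>) ` L q \<union> (\<lambda>b. b - \<epsilon>) ` R q)"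
      using q qI by blast
  qed
  moreover have "countable (\<Union>q\<in>\<rat> \<inter> I. (\<lambda>a. a + \<epsilon>) ` L q \<union> (\<lambda>b. b - \<epsilon>) ` R q)"
    using countable_left_atoms[OF m] countable_right_atoms[OF m]
    by (intro countable_UN countable_Un countable_image) (auto simp: countable_rat L_def R_def)
  ultimately show ?thesis
    by (rule countable_subset)
qed

section \<open>The smoothed measures\<close>

text \<open>
  The points at which the smoothed measure may have mass.  If \<open>x - \<epsilon>\<close> and \<open>x + \<epsilon>\<close> lie in \<open>I\<close>,
  so does the closed window between them, and no mass can escape through the ends of \<open>I\<close>.  The bound
  on \<open>\<bar>x\<bar>\<close> keeps the smoothed measure finite when \<open>I\<close> is unbounded.
  For \<open>\<epsilon> \<le> 0\<close> the set is empty, since then \<open>1 / \<epsilon> \<le> 0\<close> by the convention \<open>1 / 0 = 0\<close>.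
\<close>

definition core :: "real \<Rightarrow> real set" where
  "core \<epsilon> = {x. x - \<epsilon> \<in> I \<and> x + \<epsilon> \<in> I \<and> \<bar>x\<bar> < 1 / \<epsilon>}"

text \<open>
  The density: the average of \<open>m\<close> over the window of radius \<open>\<epsilon>\<close>, with the mass of the window truncated at
  \<open>1 / \<epsilon>\<close>, and scaled by \<open>1 - \<epsilon>\<close>.
\<close>

definition smooth_density :: "real measure \<Rightarrow> real \<Rightarrow> real \<Rightarrow> ennreal" where
  "smooth_density m \<epsilon> x =
     ennreal ((1 - \<epsilon>) / (2 * \<epsilon>)) * min (emeasure m {x - \<epsilon><..<x + \<epsilon>}) (ennreal (1 / \<epsilon>)) *
     indicator (core \<epsilon>) x"

text \<open>The measure with this density, as a measure on the whole line.\<close>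

definition smooth :: "real measure \<Rightarrow> real \<Rightarrow> real measure" where
  "smooth m \<epsilon> = density lborel (smooth_density m \<epsilon>)"

lemma open_core: "open (core \<epsilon>)"
proof -
  have "core \<epsilon> = (\<lambda>x. x - \<epsilon>) -` I \<inter> (\<lambda>x. x + \<epsilon>) -` I \<inter> {x. \<bar>x\<bar> < 1 / \<epsilon>}"
    by (auto simp: core_def)
  then show ?thesis
    by (auto intro!: open_Int open_vimage open_I continuous_intros open_Collect_less)
qed

lemma open_less_emeasure_window:
  assumes m: "m \<in> measures_on I"
  shows "open {x \<in> core \<epsilon>. c < emeasure m {x - \<epsilon><..<x + \<epsilon>}}" (is "open ?U")
proof (rule openI)
  fix x assume x: "x \<in> ?U"
  then have "x - \<epsilon> \<in> I" "x + \<epsilon> \<in> I" "c < emeasure m {x - \<epsilon><..<x + \<epsilon>}"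
    by (auto simp: core_def)
  then obtain p q where pq: "x - \<epsilon> < p" "q < x + \<epsilon>" "c < emeasure m {p<..<q}"
    using less_emeasure_Ioo_imp_rational[OF m] by metis
  obtain d where d: "d > 0" "ball x d \<subseteq> core \<epsilon>"
    using open_core x openE by blast
  let ?d = "min d (min (p - (x - \<epsilon>)) (x + \<epsilon> - q))"
  have "ball x ?d \<subseteq> ?U"
  proof
    fix y assume y: "y \<in> ball x ?d"
    then have "y \<in> core \<epsilon>"
      using d by auto
    moreover have "{p<..<q} \<subseteq> {y - \<epsilon><..<y + \<epsilon>}"
      using y by (auto simp: dist_real_def)
    ultimately have "emeasure m {p<..<q} \<le> emeasure m {y - \<epsilon><..<y + \<epsilon>}"
      using Ioo_subset[of "y - \<epsilon>" "y + \<epsilon>"] by (intro emeasure_mono_I[OF m]) (auto simp: core_def)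
    with pq(3) have "c < emeasure m {y - \<epsilon><..<y + \<epsilon>}"
      by (rule less_le_trans)
    with \<open>y \<in> core \<epsilon>\<close> show "y \<in> ?U" by simp
  qed
  moreover have "?d > 0"
    using d pq by simp
  ultimately show "\<exists>e>0. ball x e \<subseteq> ?U" by blast
qed

lemma measurable_window:
  assumes m: "m \<in> measures_on I"
  shows "(\<lambda>x. min (emeasure m {x - \<epsilon><..<x + \<epsilon>}) N * indicator (core \<epsilon>) x) \<in> borel_measurable borel"
proof (rule borel_measurableI_greater)
  fix c :: ennreal
  have "{x. c < min (emeasure m {x - \<epsilon><..<x + \<epsilon>}) N * indicator (core \<epsilon>) x} =
      (if c < N then {x \<in> core \<epsilon>. c < emeasure m {x - \<epsilon><..<x + \<epsilon>}} else {})"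
    by (auto split: split_indicator_asm split_indicator)
  then show "{x \<in> space borel. c < min (emeasure m {x - \<epsilon><..<x + \<epsilon>}) N * indicator (core \<epsilon>) x} \<in> sets borel"
    using open_less_emeasure_window[OF m] by simp
qed

lemma measurable_smooth_density:
  assumes "m \<in> measures_on I"
  shows "smooth_density m \<epsilon> \<in> borel_measurable borel"
proof -
  have "smooth_density m \<epsilon> = (\<lambda>x. ennreal ((1 - \<epsilon>) / (2 * \<epsilon>)) *
      (min (emeasure m {x - \<epsilon><..<x + \<epsilon>}) (ennreal (1 / \<epsilon>)) * indicator (core \<epsilon>) x))"
    by (simp add: smooth_density_def fun_eq_iff mult.assoc)
  then show ?thesis
    using measurable_window[OF assms] by simp
qed

lemma emeasure_smooth:
  assumes "m \<in> measures_on I" "A \<in> sets borel"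
  shows "emeasure (smooth m \<epsilon>) A = (\<integral>\<^sup>+x. smooth_density m \<epsilon> x * indicator A x \<partial>lborel)"
  unfolding smooth_def using assms measurable_smooth_density by (intro emeasure_density) auto

lemma sets_smooth [simp]: "sets (smooth m \<epsilon>) = sets borel"
  by (simp add: smooth_def)

lemma smooth_density_le:
  assumes "0 < r" "r \<le> \<epsilon>"
  shows "smooth_density m \<epsilon> x \<le> ennreal (1 / (2 * r) * (1 / r)) * indicator {-1 / r..1 / r} x"
proof (cases "x \<in> core \<epsilon>")
  case True
  have "1 / \<epsilon> \<le> 1 / r"
    using assms by (simp add: frac_le)
  with True have x: "x \<in> {-1 / r..1 / r}"
    by (auto simp: core_def abs_less_iff)
  have "(1 - \<epsilon>) / (2 * \<epsilon>) \<le> 1 / (2 * r)"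
    using assms by (intro frac_le) auto
  then have "smooth_density m \<epsilon> x \<le> ennreal (1 / (2 * r)) * ennreal (1 / r)"
    using True \<open>1 / \<epsilon> \<le> 1 / r\<close> unfolding smooth_density_def
    by (auto intro!: mult_mono ennreal_leI min.coboundedI2)
  also have "\<dots> = ennreal (1 / (2 * r) * (1 / r)) * indicator {-1 / r..1 / r} x"
    using assms x by (simp flip: ennreal_mult)
  finally show ?thesis .
qed (simp add: smooth_density_def)

lemma emeasure_smooth_finite:
  assumes m: "m \<in> measures_on I" and e: "\<epsilon> > 0"
  shows "emeasure (smooth m \<epsilon>) UNIV < \<infinity>"
proof -
  have "emeasure (smooth m \<epsilon>) UNIV = (\<integral>\<^sup>+x. smooth_density m \<epsilon> x \<partial>lborel)"
    by (simp add: emeasure_smooth[OF m])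
  also have "\<dots> \<le> (\<integral>\<^sup>+x. ennreal (1 / (2 * \<epsilon>) * (1 / \<epsilon>)) * indicator {-1 / \<epsilon>..1 / \<epsilon>} x \<partial>lborel)"
    using e by (intro nn_integral_mono smooth_density_le) auto
  also have "\<dots> < \<infinity>"
    by (rule nn_integral_dominating_finite)
  finally show ?thesis .
qed

text \<open>
  Finite Borel measures on the line are regular; regularity and finiteness pass to the
  open subset \<open>I\<close>.
\<close>

lemma restrict_finite_borel_measure_in_loc_measures_on:
  fixes \<nu> :: "real measure"
  assumes sets: "sets \<nu> = sets borel" and fin: "emeasure \<nu> UNIV < \<infinity>"
  shows "restrict_space \<nu> I \<in> loc_measures_on I"
proof -
  have space: "space \<nu> = UNIV"
    using sets_eq_imp_space_eq[OF sets] by simp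
  have I: "I \<inter> space \<nu> \<in> sets \<nu>"
    using open_I by (simp add: sets)
  have em: "emeasure (restrict_space \<nu> I) A = emeasure \<nu> A" if "A \<subseteq> I" for A
    using I that by (rule emeasure_restrict_space)
  have S: "sets (restrict_space \<nu> I) = sets (restrict_space borel I)"
    using sets by (rule sets_restrict_space_cong)
  have fin': "emeasure \<nu> (space \<nu>) \<noteq> \<infinity>"
    using fin by (simp add: space)
  have "regular_on I (restrict_space \<nu> I)"
    unfolding regular_on_def
  proof (intro ballI conjI)
    fix A assume "A \<in> sets (restrict_space borel I)"
    then have A: "A \<subseteq> I" "A \<in> sets borel"
      using open_I by (auto simp: sets_restrict_space_iff)
    have "(SUP K \<in> {K. compact K \<and> K \<subseteq> A}. emeasure (restrict_space \<nu> I) K) =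
        (SUP K \<in> {K. K \<subseteq> A \<and> compact K}. emeasure \<nu> K)"
      using A by (intro SUP_cong) (auto intro!: em)
    then show "emeasure (restrict_space \<nu> I) A =
        (SUP K \<in> {K. compact K \<and> K \<subseteq> A}. emeasure (restrict_space \<nu> I) K)"
      using inner_regular[OF sets fin' A(2)] em[OF A(1)] by simp
    have "emeasure \<nu> A = (INF U \<in> {U. A \<subseteq> U \<and> open U}. emeasure \<nu> U)"
      by (rule outer_regular[OF sets fin' A(2)])
    moreover have "(INF U \<in> {U. openin (top_of_set I) U \<and> A \<subseteq> U}. emeasure (restrict_space \<nu> I) U)
        \<le> (INF U \<in> {U. A \<subseteq> U \<and> open U}. emeasure \<nu> U)"
    proof (rule INF_mono)
      fix U assume "U \<in> {U. A \<subseteq> U \<and> open U}"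
      then have "openin (top_of_set I) (U \<inter> I)" "A \<subseteq> U \<inter> I" "U \<in> sets \<nu>"
        using A by (auto simp: sets openin_open)
      moreover from this have "emeasure (restrict_space \<nu> I) (U \<inter> I) \<le> emeasure \<nu> U"
        by (subst em) (auto intro: emeasure_mono)
      ultimately show "\<exists>V \<in> {U. openin (top_of_set I) U \<and> A \<subseteq> U}.
          emeasure (restrict_space \<nu> I) V \<le> emeasure \<nu> U"
        by blast
    qed
    moreover have "emeasure \<nu> A \<le> (INF U \<in> {U. openin (top_of_set I) U \<and> A \<subseteq> U}. emeasure (restrict_space \<nu> I) U)"
    proof (rule INF_greatest)
      fix U assume U: "U \<in> {U. openin (top_of_set I) U \<and> A \<subseteq> U}"
      then have "open U" "U \<subseteq> I"
        using open_I by (auto simp: openin_open_eq)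
      then show "emeasure \<nu> A \<le> emeasure (restrict_space \<nu> I) U"
        using U by (subst em) (auto intro!: emeasure_mono simp: sets)
    qed
    ultimately show "emeasure (restrict_space \<nu> I) A =
        (INF U \<in> {U. openin (top_of_set I) U \<and> A \<subseteq> U}. emeasure (restrict_space \<nu> I) U)"
      using em[OF A(1)] by simp
  qed
  moreover have "locally_finite_on I (restrict_space \<nu> I)"
    unfolding locally_finite_on_def
  proof (intro ballI exI conjI)
    fix x assume "x \<in> I"
    then show "x \<in> I" .
    show "openin (top_of_set I) I" by simp
    have "emeasure \<nu> I \<le> emeasure \<nu> UNIV"
      by (rule emeasure_mono) (auto simp: sets)
    with fin show "emeasure (restrict_space \<nu> I) I < \<infinity>"
      by (simp add: em)
  qed
  ultimately show ?thesis
    by (simp add: loc_measures_on_def measures_on_def S)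
qed

section \<open>Continuity at positive radius\<close>

lemma finite_ends: "finite (ereal -` {\<alpha>, \<beta>})"
  by (intro finite_vimageI) (auto simp: inj_on_def)

lemma closure_I_subset: "closure I \<subseteq> I \<union> ereal -` {\<alpha>, \<beta>}"
proof -
  have "closed {x. \<alpha> \<le> ereal x \<and> ereal x \<le> \<beta>}"
    by (intro closed_Collect_conj closed_Collect_le continuous_intros)
  then have "closure I \<subseteq> {x. \<alpha> \<le> ereal x \<and> ereal x \<le> \<beta>}"
    by (intro closure_minimal) (auto simp: I_eq einterval_iff)
  then show ?thesis
    by (auto simp: I_eq einterval_iff order_le_less)
qed

lemma smooth_density_tendsto:
  assumes conv: "theta_tendsto \<mu> m" "m \<in> measures_on I" "\<And>n. \<mu> n \<in> measures_on I"
    and e: "e \<longlonglongrightarrow> \<epsilon>" "\<epsilon> > 0"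
    and no_atoms: "x - \<epsilon> \<in> I \<Longrightarrow> x + \<epsilon> \<in> I \<Longrightarrow>
      emeasure m {x - \<epsilon>..x + \<epsilon>} = emeasure m {x - \<epsilon><..<x + \<epsilon>}"
    and no_ends: "x - \<epsilon> \<notin> ereal -` {\<alpha>, \<beta>}" "x + \<epsilon> \<notin> ereal -` {\<alpha>, \<beta>}" "\<bar>x\<bar> \<noteq> 1 / \<epsilon>"
  shows "(\<lambda>n. smooth_density (\<mu> n) (e n) x) \<longlonglongrightarrow> smooth_density m \<epsilon> x"
proof -
  have lim: "(\<lambda>n. x - e n) \<longlonglongrightarrow> x - \<epsilon>" "(\<lambda>n. x + e n) \<longlonglongrightarrow> x + \<epsilon>" "(\<lambda>n. 1 / e n) \<longlonglongrightarrow> 1 / \<epsilon>"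
    using e by (auto intro!: tendsto_intros)
  show ?thesis
  proof (cases "x \<in> core \<epsilon>")
    case True
    then have I: "x - \<epsilon> \<in> I" "x + \<epsilon> \<in> I" "\<bar>x\<bar> < 1 / \<epsilon>"
      by (auto simp: core_def)
    have evI: "\<forall>\<^sub>F n in sequentially. x - e n \<in> I" "\<forall>\<^sub>F n in sequentially. x + e n \<in> I"
      using eventually_in_I lim I by blast+
    have window: "(\<lambda>n. emeasure (\<mu> n) {x - e n<..<x + e n}) \<longlonglongrightarrow> emeasure m {x - \<epsilon><..<x + \<epsilon>}"
    proof (rule order_tendstoI)
      fix c assume "c < emeasure m {x - \<epsilon><..<x + \<epsilon>}"
      then show "\<forall>\<^sub>F n in sequentially. c < emeasure (\<mu> n) {x - e n<..<x + e n}"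
        by (rule theta_tendsto_Ioo[OF conv lim(1,2) I(1,2)])
    next
      fix c assume "emeasure m {x - \<epsilon><..<x + \<epsilon>} < c"
      then have "emeasure m {x - \<epsilon>..x + \<epsilon>} < c"
        using no_atoms I by simp
      then have "\<forall>\<^sub>F n in sequentially. emeasure (\<mu> n) {x - e n..x + e n} < c"
        using e by (intro theta_tendsto_Icc[OF conv lim(1,2) I(1,2)]) auto
      with evI show "\<forall>\<^sub>F n in sequentially. emeasure (\<mu> n) {x - e n<..<x + e n} < c"
      proof eventually_elim
        case (elim n)
        then have "emeasure (\<mu> n) {x - e n<..<x + e n} \<le> emeasure (\<mu> n) {x - e n..x + e n}"
          using Icc_subset[of "x - e n" "x + e n"] by (intro emeasure_mono_I[OF conv(3)]) auto
        with elim show ?case by simp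
      qed
    qed
    have coeff: "(\<lambda>n. (1 - e n) / (2 * e n)) \<longlonglongrightarrow> (1 - \<epsilon>) / (2 * \<epsilon>)"
      using e by (auto intro!: tendsto_intros)
    have "\<forall>\<^sub>F n in sequentially. \<bar>x\<bar> < 1 / e n"
      using order_tendstoD(1)[OF lim(3) I(3)] .
    with evI have "\<forall>\<^sub>F n in sequentially. x \<in> core (e n)"
      by eventually_elim (simp add: core_def)
    then have "\<forall>\<^sub>F n in sequentially.
        ennreal ((1 - e n) / (2 * e n)) * min (emeasure (\<mu> n) {x - e n<..<x + e n}) (ennreal (1 / e n)) =
        smooth_density (\<mu> n) (e n) x"
      by eventually_elim (simp add: smooth_density_def)
    moreover have "(\<lambda>n. ennreal ((1 - e n) / (2 * e n)) *
        min (emeasure (\<mu> n) {x - e n<..<x + e n}) (ennreal (1 / e n))) \<longlonglongrightarrow>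
        ennreal ((1 - \<epsilon>) / (2 * \<epsilon>)) * min (emeasure m {x - \<epsilon><..<x + \<epsilon>}) (ennreal (1 / \<epsilon>))"
      by (intro tendsto_mult_ennreal tendsto_min window tendsto_ennrealI coeff lim(3))
        (auto simp: min_def top_unique)
    ultimately show ?thesis
      using True by (auto simp: smooth_density_def elim: Lim_transform_eventually)
  next
    case False
    have "\<forall>\<^sub>F n in sequentially. x \<notin> core (e n)"
    proof -
      consider "x - \<epsilon> \<in> - closure I" | "x + \<epsilon> \<in> - closure I" | "1 / \<epsilon> < \<bar>x\<bar>"
        using False closure_I_subset no_ends by (force simp: core_def)
      then show ?thesis
      proof cases
        case 1
        have "\<forall>\<^sub>F n in sequentially. x - e n \<in> - closure I"
          by (rule topological_tendstoD[OF lim(1) _ 1]) auto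
        then show ?thesis
          by eventually_elim (use closure_subset[of I] in \<open>auto simp: core_def\<close>)
      next
        case 2
        have "\<forall>\<^sub>F n in sequentially. x + e n \<in> - closure I"
          by (rule topological_tendstoD[OF lim(2) _ 2]) auto
        then show ?thesis
          by eventually_elim (use closure_subset[of I] in \<open>auto simp: core_def\<close>)
      next
        case 3
        have "\<forall>\<^sub>F n in sequentially. 1 / e n < \<bar>x\<bar>"
          using order_tendstoD(2)[OF lim(3) 3] .
        then show ?thesis
          by eventually_elim (auto simp: core_def)
      qed
    qed
    then have "\<forall>\<^sub>F n in sequentially. 0 = smooth_density (\<mu> n) (e n) x"
      by eventually_elim (simp add: smooth_density_def)
    then show ?thesis
      using False by (auto simp: smooth_density_def[of m] intro: Lim_transform_eventually)
  qed
qed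

lemma emeasure_smooth_tendsto:
  assumes conv: "theta_tendsto \<mu> m" "m \<in> measures_on I" "\<And>n. \<mu> n \<in> measures_on I"
    and e: "e \<longlonglongrightarrow> \<epsilon>" "\<epsilon> > 0" and A: "A \<in> sets borel"
  shows "(\<lambda>n. emeasure (smooth (\<mu> n) (e n)) A) \<longlonglongrightarrow> emeasure (smooth m \<epsilon>) A"
proof -
  \<comment> \<open>A radius that bounds \<open>e n\<close> from below for large \<open>n\<close>; it yields the dominating function \<open>?w\<close>.\<close>
  define r where "r = \<epsilon> / 2"
  have r: "0 < r" "r < \<epsilon>"
    using e by (auto simp: r_def)
  obtain N where N: "\<And>n. n \<ge> N \<Longrightarrow> r < e n"
    using order_tendstoD(1)[OF e(1) r(2)] by (auto simp: eventually_sequentially)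
  let ?w = "\<lambda>x. ennreal (1 / (2 * r) * (1 / r)) * indicator {-1 / r..1 / r} x"
  define Z where "Z = {x. x - \<epsilon> \<in> I \<and> x + \<epsilon> \<in> I \<and>
           emeasure m {x - \<epsilon>..x + \<epsilon>} \<noteq> emeasure m {x - \<epsilon><..<x + \<epsilon>}} \<union>
      (\<lambda>y. y + \<epsilon>) ` (ereal -` {\<alpha>, \<beta>}) \<union> (\<lambda>y. y - \<epsilon>) ` (ereal -` {\<alpha>, \<beta>}) \<union> {-1 / \<epsilon>, 1 / \<epsilon>}"
  have "countable Z"
    unfolding Z_def using countable_Icc_neq_Ioo[OF conv(2) e(2)] finite_ends
    by (intro countable_Un countable_image) (auto intro: countable_finite)
  then have AE: "AE x in lborel. x \<notin> Z"
    by (intro AE_not_in countable_imp_null_set_lborel)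
  have "(\<lambda>n. \<integral>\<^sup>+x. smooth_density (\<mu> (n + N)) (e (n + N)) x * indicator A x \<partial>lborel) \<longlonglongrightarrow>
      (\<integral>\<^sup>+x. smooth_density m \<epsilon> x * indicator A x \<partial>lborel)"
  proof (rule nn_integral_dominated_convergence[where w = ?w])
    show "(\<lambda>x. smooth_density (\<mu> (i + N)) (e (i + N)) x * indicator A x) \<in> borel_measurable lborel" for i
      using measurable_smooth_density[OF conv(3)] A by simp
    show "(\<lambda>x. smooth_density m \<epsilon> x * indicator A x) \<in> borel_measurable lborel"
      using measurable_smooth_density[OF conv(2)] A by simp
    show "?w \<in> borel_measurable lborel" by simp
    show "(\<integral>\<^sup>+x. ?w x \<partial>lborel) < \<infinity>"
      by (rule nn_integral_dominating_finite)
    show "AE x in lborel. smooth_density (\<mu> (j + N)) (e (j + N)) x * indicator A x \<le> ?w x" for j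
    proof (rule AE_I2)
      fix x
      have "smooth_density (\<mu> (j + N)) (e (j + N)) x \<le> ?w x"
        using N[of "j + N"] r by (intro smooth_density_le) auto
      then show "smooth_density (\<mu> (j + N)) (e (j + N)) x * indicator A x \<le> ?w x"
        by (cases "x \<in> A") auto
    qed
    show "AE x in lborel. (\<lambda>i. smooth_density (\<mu> (i + N)) (e (i + N)) x * indicator A x) \<longlonglongrightarrow>
        smooth_density m \<epsilon> x * indicator A x"
      using AE
    proof eventually_elim
      case (elim x)
      have "x \<in> Z" if "x - \<epsilon> \<in> ereal -` {\<alpha>, \<beta>}"
        using imageI[OF that, of "\<lambda>y. y + \<epsilon>"] by (simp add: Z_def)
      moreover have "x \<in> Z" if "x + \<epsilon> \<in> ereal -` {\<alpha>, \<beta>}"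
        using imageI[OF that, of "\<lambda>y. y - \<epsilon>"] by (simp add: Z_def)
      moreover have "x \<in> Z" if "\<bar>x\<bar> = 1 / \<epsilon>"
        using that by (simp add: Z_def abs_if split: if_splits)
      moreover have "x \<in> Z" if "x - \<epsilon> \<in> I" "x + \<epsilon> \<in> I"
          "emeasure m {x - \<epsilon>..x + \<epsilon>} \<noteq> emeasure m {x - \<epsilon><..<x + \<epsilon>}"
        using that by (simp add: Z_def)
      ultimately have "x - \<epsilon> \<notin> ereal -` {\<alpha>, \<beta>}" "x + \<epsilon> \<notin> ereal -` {\<alpha>, \<beta>}" "\<bar>x\<bar> \<noteq> 1 / \<epsilon>"
        "x - \<epsilon> \<in> I \<Longrightarrow> x + \<epsilon> \<in> I \<Longrightarrow> emeasure m {x - \<epsilon>..x + \<epsilon>} = emeasure m {x - \<epsilon><..<x + \<epsilon>}"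
        using elim by blast+
      then have "(\<lambda>n. smooth_density (\<mu> n) (e n) x) \<longlonglongrightarrow> smooth_density m \<epsilon> x"
        by (intro smooth_density_tendsto conv e) auto
      then have "(\<lambda>n. smooth_density (\<mu> (n + N)) (e (n + N)) x) \<longlonglongrightarrow> smooth_density m \<epsilon> x"
        by (rule LIMSEQ_ignore_initial_segment)
      then show ?case
        by (cases "x \<in> A") auto
    qed
  qed
  then have "(\<lambda>n. emeasure (smooth (\<mu> (n + N)) (e (n + N))) A) \<longlonglongrightarrow> emeasure (smooth m \<epsilon>) A"
    using A conv by (simp add: emeasure_smooth)
  then show ?thesis
    by (rule LIMSEQ_offset)
qed

section \<open>Comparison of a measure with its smoothing\<close>

text \<open>
  The measure \<open>m\<close> is not \<open>\<sigma>\<close>-finite in general, so Fubini's theorem is applied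
  to its restriction to a set \<open>J\<close> of finite measure.
\<close>

lemma
  fixes J :: "real set"
  assumes m: "m \<in> measures_on I" and J: "J \<subseteq> I" "J \<in> sets borel" "emeasure m J < \<infinity>"
    and A: "A \<in> sets borel"
  shows nn_integral_window: "(\<integral>\<^sup>+x. emeasure m (J \<inter> {x - \<epsilon><..<x + \<epsilon>}) * indicator A x \<partial>lborel) =
           (\<integral>\<^sup>+y. emeasure lborel (A \<inter> {y - \<epsilon><..<y + \<epsilon>}) \<partial>restrict_space m J)" (is ?eq)
    and measurable_finite_window:
      "(\<lambda>x. emeasure m (J \<inter> {x - \<epsilon><..<x + \<epsilon>}) * indicator A x) \<in> borel_measurable borel" (is ?meas)
proof -
  define \<nu> where "\<nu> = restrict_space m J"
  have Jm: "J \<inter> space m \<in> sets m"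
    using J by (simp add: space_measures_on[OF m] sets_measures_on[OF m] Int_absorb2)
  have space: "space \<nu> = J"
    using J(1) by (auto simp: \<nu>_def space_restrict_space space_measures_on[OF m])
  have em: "emeasure \<nu> B = emeasure m B" if "B \<subseteq> J" for B
    unfolding \<nu>_def using Jm that by (rule emeasure_restrict_space)
  have sets: "B \<in> sets \<nu> \<longleftrightarrow> B \<subseteq> J \<and> B \<in> sets borel" for B
    using Jm J(1) by (auto simp: \<nu>_def sets_restrict_space_iff sets_measures_on[OF m])
  interpret \<nu>: finite_measure \<nu>
    using J(3) by (intro finite_measureI) (simp add: space em)
  interpret pair_sigma_finite \<nu> lborel ..
  have id: "(\<lambda>y. y) \<in> borel_measurable \<nu>"
    using J(2) by (intro measurableI) (auto simp: space sets)
  have [measurable]: "fst \<in> borel_measurable (\<nu> \<Otimes>\<^sub>M lborel)"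
    using measurable_compose[OF measurable_fst[of \<nu> lborel] id] by simp
  have [measurable]: "snd \<in> borel_measurable (\<nu> \<Otimes>\<^sub>M lborel)"
    using measurable_snd[of \<nu> lborel] by simp
  note A[measurable]
  define f :: "real \<Rightarrow> real \<Rightarrow> ennreal" where
    "f y x = (if \<bar>y - x\<bar> < \<epsilon> \<and> x \<in> A then 1 else 0)" for y x
  have f: "case_prod f \<in> borel_measurable (\<nu> \<Otimes>\<^sub>M lborel)"
    unfolding f_def case_prod_beta by measurable
  have inner: "(\<integral>\<^sup>+y. f y x \<partial>\<nu>) = emeasure m (J \<inter> {x - \<epsilon><..<x + \<epsilon>}) * indicator A x" for x
  proof -
    have "(\<integral>\<^sup>+y. f y x \<partial>\<nu>) = (\<integral>\<^sup>+y. indicator A x * indicator (J \<inter> {x - \<epsilon><..<x + \<epsilon>}) y \<partial>\<nu>)"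
      by (intro nn_integral_cong) (auto simp: f_def space split: split_indicator)
    also have "\<dots> = indicator A x * emeasure \<nu> (J \<inter> {x - \<epsilon><..<x + \<epsilon>})"
      using J by (intro nn_integral_cmult_indicator) (auto simp: sets)
    finally show ?thesis
      by (simp add: em mult.commute)
  qed
  have outer: "(\<integral>\<^sup>+x. f y x \<partial>lborel) = emeasure lborel (A \<inter> {y - \<epsilon><..<y + \<epsilon>})" for y
  proof -
    have "(\<integral>\<^sup>+x. f y x \<partial>lborel) = (\<integral>\<^sup>+x. indicator (A \<inter> {y - \<epsilon><..<y + \<epsilon>}) x \<partial>lborel)"
      by (intro nn_integral_cong) (auto simp: f_def split: split_indicator)
    then show ?thesis by simp
  qed
  show ?eq
    using Fubini'[OF f] by (simp add: inner outer flip: \<nu>_def)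
  have "(\<lambda>x. \<integral>\<^sup>+y. f y x \<partial>\<nu>) \<in> borel_measurable lborel"
    using f by (intro \<nu>.borel_measurable_nn_integral) (simp add: measurable_pair_swap_iff[of _ lborel \<nu>] case_prod_beta)
  then show ?meas
    by (simp add: inner)
qed

lemma emeasure_smooth_le:
  assumes m: "m \<in> measures_on I" and e: "0 < \<epsilon>"
    and I: "a - \<epsilon> \<in> I" "b + \<epsilon> \<in> I"
  shows "emeasure (smooth m \<epsilon>) {a..b} \<le> emeasure m {a - \<epsilon>..b + \<epsilon>}"
proof (cases "emeasure m {a - \<epsilon>..b + \<epsilon>} = \<infinity>")
  case False
  define J where "J = {a - \<epsilon>..b + \<epsilon>}"
  have J: "J \<subseteq> I" "J \<in> sets borel" "emeasure m J < \<infinity>"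
    using False Icc_subset[OF I] by (auto simp: J_def less_top)
  let ?g = "\<lambda>x. emeasure m (J \<inter> {x - \<epsilon><..<x + \<epsilon>}) * indicator {a..b} x"
  have "emeasure (smooth m \<epsilon>) {a..b} = (\<integral>\<^sup>+x. smooth_density m \<epsilon> x * indicator {a..b} x \<partial>lborel)"
    by (simp add: emeasure_smooth[OF m])
  also have "\<dots> \<le> (\<integral>\<^sup>+x. ennreal (1 / (2 * \<epsilon>)) * ?g x \<partial>lborel)"
  proof (intro nn_integral_mono)
    fix x
    have "smooth_density m \<epsilon> x \<le> ennreal (1 / (2 * \<epsilon>)) * emeasure m (J \<inter> {x - \<epsilon><..<x + \<epsilon>})"
      if "x \<in> {a..b}"
    proof -
      have "J \<inter> {x - \<epsilon><..<x + \<epsilon>} = {x - \<epsilon><..<x + \<epsilon>}"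
        using that by (auto simp: J_def)
      then have "smooth_density m \<epsilon> x \<le>
          ennreal ((1 - \<epsilon>) / (2 * \<epsilon>)) * emeasure m (J \<inter> {x - \<epsilon><..<x + \<epsilon>})"
        by (auto simp: smooth_density_def intro!: mult_left_mono split: split_indicator)
      also have "\<dots> \<le> ennreal (1 / (2 * \<epsilon>)) * emeasure m (J \<inter> {x - \<epsilon><..<x + \<epsilon>})"
        using e by (intro mult_right_mono ennreal_leI divide_right_mono) auto
      finally show ?thesis .
    qed
    then show "smooth_density m \<epsilon> x * indicator {a..b} x \<le> ennreal (1 / (2 * \<epsilon>)) * ?g x"
      by (auto split: split_indicator)
  qed
  also have "\<dots> = ennreal (1 / (2 * \<epsilon>)) * (\<integral>\<^sup>+x. ?g x \<partial>lborel)"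
    using measurable_finite_window[OF m J, of "{a..b}"] by (intro nn_integral_cmult) auto
  also have "(\<integral>\<^sup>+x. ?g x \<partial>lborel) =
      (\<integral>\<^sup>+y. emeasure lborel ({a..b} \<inter> {y - \<epsilon><..<y + \<epsilon>}) \<partial>restrict_space m J)"
    by (rule nn_integral_window[OF m J]) simp
  also have "\<dots> \<le> (\<integral>\<^sup>+y. ennreal (2 * \<epsilon>) \<partial>restrict_space m J)"
  proof (intro nn_integral_mono)
    fix y
    have "emeasure lborel ({a..b} \<inter> {y - \<epsilon><..<y + \<epsilon>}) \<le> emeasure lborel {y - \<epsilon><..<y + \<epsilon>}"
      by (intro emeasure_mono) auto
    also have "\<dots> = ennreal (2 * \<epsilon>)"
      using e by simp
    finally show "emeasure lborel ({a..b} \<inter> {y - \<epsilon><..<y + \<epsilon>}) \<le> ennreal (2 * \<epsilon>)" .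
  qed
  also have "\<dots> = ennreal (2 * \<epsilon>) * emeasure m J"
    using J by (simp add: space_restrict_space emeasure_restrict_space space_measures_on[OF m]
        sets_measures_on[OF m] Int_absorb2)
  also have "ennreal (1 / (2 * \<epsilon>)) * (ennreal (2 * \<epsilon>) * emeasure m J) = emeasure m J"
    using e by (simp flip: mult.assoc ennreal_mult)
  finally show ?thesis
    by (simp add: J_def mult_left_mono)
qed simp

text \<open>
  If every point of \<open>[p,q]\<close> lies in a window of finite mass, finitely many such windows cover \<open>[p,q]\<close>.
  Otherwise all windows around some point \<open>y\<close> of \<open>[p,q]\<close> have infinite mass.
\<close>

lemma finite_or_infinite_window:
  assumes m: "m \<in> measures_on I" and e: "0 < \<epsilon>" and core: "{p - \<epsilon><..<q + \<epsilon>} \<subseteq> core \<epsilon>"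
  obtains "emeasure m {p<..<q} < \<infinity>"
  | y where "y \<in> {p..q}" "\<And>x. x \<in> {y - \<epsilon><..<y + \<epsilon>} \<Longrightarrow> emeasure m {x - \<epsilon><..<x + \<epsilon>} = \<infinity>"
proof (cases "\<exists>y\<in>{p..q}. \<forall>x\<in>{y - \<epsilon><..<y + \<epsilon>}. emeasure m {x - \<epsilon><..<x + \<epsilon>} = \<infinity>")
  case True
  with that(2) show ?thesis by blast
next
  case False
  define X where "X = {x \<in> core \<epsilon>. emeasure m {x - \<epsilon><..<x + \<epsilon>} < \<infinity>}"
  have win: "{x - \<epsilon><..<x + \<epsilon>} \<subseteq> I" if "x \<in> core \<epsilon>" for x
    using that by (intro Ioo_subset) (auto simp: core_def)
  have "\<exists>x\<in>X. y \<in> {x - \<epsilon><..<x + \<epsilon>}" if y: "y \<in> {p..q}" for y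
  proof -
    obtain x where "x \<in> {y - \<epsilon><..<y + \<epsilon>}" "emeasure m {x - \<epsilon><..<x + \<epsilon>} \<noteq> \<infinity>"
      using False y by blast
    moreover from this have "x \<in> core \<epsilon>"
      using core y by (intro subsetD[OF core]) auto
    ultimately show ?thesis
      by (intro bexI[of _ x]) (auto simp: X_def less_top)
  qed
  then have "{p..q} \<subseteq> (\<Union>x\<in>X. {x - \<epsilon><..<x + \<epsilon>})"
    by blast
  then obtain F where F: "F \<subseteq> X" "finite F" "{p..q} \<subseteq> (\<Union>x\<in>F. {x - \<epsilon><..<x + \<epsilon>})"
    by (rule compactE_image[OF compact_Icc, rotated]) auto
  have FI: "(\<Union>x\<in>F. {x - \<epsilon><..<x + \<epsilon>}) \<subseteq> I"
    using win F(1) by (auto simp: X_def)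
  have "emeasure m {p<..<q} \<le> emeasure m (\<Union>x\<in>F. {x - \<epsilon><..<x + \<epsilon>})"
    using FI by (intro emeasure_mono_I[OF m] order_trans[OF _ F(3)] borel_open open_UN) auto
  also have "\<dots> \<le> (\<Sum>x\<in>F. emeasure m {x - \<epsilon><..<x + \<epsilon>})"
    using F win by (intro emeasure_subadditive_finite) (auto simp: sets_measures_on[OF m] X_def)
  also have "\<dots> < \<infinity>"
    using F by (auto simp: X_def)
  finally show ?thesis
    using that(1) by blast
qed

text \<open>
  In the second case of the preceding lemma the density is \<open>(1 - \<epsilon>) / (2 \<epsilon>\<^sup>2)\<close> on a whole window, of length
  \<open>2 \<epsilon>\<close>.  In the first case, where \<open>M = m (p,q)\<close> is finite and may be assumed positive, concavity of the
  truncation gives \<open>min t (1 / \<epsilon>) \<ge> t * min M (1 / \<epsilon>) / M\<close> for \<open>t \<le> M\<close>; here \<open>t\<close> is the mass of the part of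
  a window in \<open>(p,q)\<close>, and the right side is integrated by Fubini's theorem.
\<close>

lemma emeasure_smooth_ge:
  assumes m: "m \<in> measures_on I" and e: "0 < \<epsilon>" "\<epsilon> \<le> 1"
    and core: "{p - \<epsilon><..<q + \<epsilon>} \<subseteq> core \<epsilon>"
  shows "ennreal (1 - \<epsilon>) * min (emeasure m {p<..<q}) (ennreal (1 / \<epsilon>)) \<le>
    emeasure (smooth m \<epsilon>) {p - \<epsilon><..<q + \<epsilon>}" (is "?lhs \<le> _")
proof -
  let ?A = "{p - \<epsilon><..<q + \<epsilon>}"
  let ?c = "ennreal ((1 - \<epsilon>) / (2 * \<epsilon>))"
  have em: "emeasure (smooth m \<epsilon>) ?A = (\<integral>\<^sup>+x. smooth_density m \<epsilon> x * indicator ?A x \<partial>lborel)"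
    by (simp add: emeasure_smooth[OF m])
  have dens: "smooth_density m \<epsilon> x = ?c * min (emeasure m {x - \<epsilon><..<x + \<epsilon>}) (ennreal (1 / \<epsilon>))"
    if "x \<in> ?A" for x
    using that core by (auto simp: smooth_density_def)
  have c: "?c * ennreal (2 * \<epsilon>) = ennreal (1 - \<epsilon>)"
    using e by (simp flip: ennreal_mult)
  show ?thesis
  proof (rule finite_or_infinite_window[OF m e(1) core])
    fix y assume y: "y \<in> {p..q}"
      and inf: "\<And>x. x \<in> {y - \<epsilon><..<y + \<epsilon>} \<Longrightarrow> emeasure m {x - \<epsilon><..<x + \<epsilon>} = \<infinity>"
    have "?lhs \<le> ennreal (1 - \<epsilon>) * ennreal (1 / \<epsilon>)"
      by (intro mult_left_mono) auto
    also have "\<dots> = ?c * ennreal (1 / \<epsilon>) * emeasure lborel {y - \<epsilon><..<y + \<epsilon>}"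
      using e by (simp add: c[symmetric] mult_ac)
    also have "\<dots> = (\<integral>\<^sup>+x. ?c * ennreal (1 / \<epsilon>) * indicator {y - \<epsilon><..<y + \<epsilon>} x \<partial>lborel)"
      by (rule nn_integral_cmult_indicator[symmetric]) simp
    also have "\<dots> \<le> emeasure (smooth m \<epsilon>) ?A"
      unfolding em
    proof (intro nn_integral_mono)
      fix x
      show "?c * ennreal (1 / \<epsilon>) * indicator {y - \<epsilon><..<y + \<epsilon>} x \<le> smooth_density m \<epsilon> x * indicator ?A x"
      proof (cases "x \<in> {y - \<epsilon><..<y + \<epsilon>}")
        case True
        then have "x \<in> ?A"
          using y by auto
        then show ?thesis
          using True by (simp add: dens inf)
      qed simp
    qed
    finally show ?thesis .
  next
    assume fin: "emeasure m {p<..<q} < \<infinity>"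
    define J where "J = {p<..<q}"
    define M where "M = emeasure m J"
    define k where "k = min M (ennreal (1 / \<epsilon>))"
    have "J \<subseteq> I"
    proof
      fix y assume "y \<in> J"
      then have "y \<in> core \<epsilon>"
        using e by (intro subsetD[OF core]) (auto simp: J_def)
      then show "y \<in> I"
        using Icc_subset[of "y - \<epsilon>" "y + \<epsilon>"] e by (auto simp: core_def)
    qed
    then have J: "J \<subseteq> I" "J \<in> sets borel" "emeasure m J < \<infinity>"
      using fin by (auto simp: J_def)
    have M: "M < \<infinity>"
      using J by (simp add: M_def)
    show ?thesis
    proof (cases "M = 0")
      case False
      let ?g = "\<lambda>x. emeasure m (J \<inter> {x - \<epsilon><..<x + \<epsilon>}) * indicator ?A x"
      have k: "k / M * M = k"
        using False M by (simp add: ennreal_divide_times ennreal_mult_divide_eq flip: ennreal_times_divide)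
      have k1: "k / M \<le> 1"
        using False M by (intro divide_le_posI_ennreal) (auto simp: k_def zero_less_iff_neq_zero)
      have int: "(\<integral>\<^sup>+x. ?g x \<partial>lborel) = ennreal (2 * \<epsilon>) * M"
      proof -
        have "(\<integral>\<^sup>+x. ?g x \<partial>lborel) =
            (\<integral>\<^sup>+y. emeasure lborel (?A \<inter> {y - \<epsilon><..<y + \<epsilon>}) \<partial>restrict_space m J)"
          by (rule nn_integral_window[OF m J]) simp
        also have "\<dots> = (\<integral>\<^sup>+y. ennreal (2 * \<epsilon>) \<partial>restrict_space m J)"
        proof (intro nn_integral_cong)
          fix y assume "y \<in> space (restrict_space m J)"
          then have "?A \<inter> {y - \<epsilon><..<y + \<epsilon>} = {y - \<epsilon><..<y + \<epsilon>}"
            by (auto simp: space_restrict_space J_def)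
          then show "emeasure lborel (?A \<inter> {y - \<epsilon><..<y + \<epsilon>}) = ennreal (2 * \<epsilon>)"
            using e by simp
        qed
        also have "\<dots> = ennreal (2 * \<epsilon>) * M"
          using J by (simp add: M_def space_restrict_space emeasure_restrict_space space_measures_on[OF m]
              sets_measures_on[OF m] Int_absorb2)
        finally show ?thesis .
      qed
      have "?lhs = ?c * ennreal (2 * \<epsilon>) * (k / M * M)"
        unfolding c k by (simp add: k_def M_def J_def)
      also have "\<dots> = ?c * (k / M) * (ennreal (2 * \<epsilon>) * M)"
        by (simp only: mult_ac)
      also have "\<dots> = (\<integral>\<^sup>+x. ?c * (k / M) * ?g x \<partial>lborel)"
        using measurable_finite_window[OF m J, of ?A]
        by (subst nn_integral_cmult) (auto simp: int)
      also have "\<dots> \<le> emeasure (smooth m \<epsilon>) ?A"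
        unfolding em
      proof (intro nn_integral_mono)
        fix x
        show "?c * (k / M) * ?g x \<le> smooth_density m \<epsilon> x * indicator ?A x"
        proof (cases "x \<in> ?A")
          case True
          let ?t = "emeasure m (J \<inter> {x - \<epsilon><..<x + \<epsilon>})"
          have "x \<in> core \<epsilon>"
            using True core by blast
          then have win: "{x - \<epsilon><..<x + \<epsilon>} \<subseteq> I"
            by (intro Ioo_subset) (auto simp: core_def)
          have "?t \<le> M"
            unfolding M_def using J by (intro emeasure_mono_I[OF m]) auto
          then have "k / M * ?t \<le> k / M * M"
            by (rule mult_left_mono) simp
          also have "\<dots> \<le> ennreal (1 / \<epsilon>)"
            unfolding k by (simp add: k_def)
          finally have "k / M * ?t \<le> ennreal (1 / \<epsilon>)" .
          moreover have "k / M * ?t \<le> 1 * emeasure m {x - \<epsilon><..<x + \<epsilon>}"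
            using win by (intro mult_mono k1 emeasure_mono_I[OF m]) auto
          ultimately have "?c * (k / M * ?t) \<le> smooth_density m \<epsilon> x"
            unfolding dens[OF True] by (intro mult_left_mono) auto
          then show ?thesis
            using True by (simp add: mult.assoc)
        qed simp
      qed
      finally show ?thesis .
    qed (simp add: M_def J_def)
  qed
qed

section \<open>The contraction\<close>

text \<open>The deformation of \<open>\<M>(I)\<close>; the second component of the argument is the radius.\<close>

definition contraction :: "real measure \<times> real \<Rightarrow> real measure" where
  "contraction = (\<lambda>(m, \<epsilon>). if \<epsilon> = 0 then m else restrict_space (smooth m \<epsilon>) I)"

lemma emeasure_contraction:
  assumes "\<epsilon> \<noteq> 0" "A \<subseteq> I"
  shows "emeasure (contraction (m, \<epsilon>)) A = emeasure (smooth m \<epsilon>) A"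
  using assms open_I by (simp add: contraction_def emeasure_restrict_space)

lemma contraction_in_loc_measures_on:
  assumes "m \<in> measures_on I" "\<epsilon> > 0"
  shows "contraction (m, \<epsilon>) \<in> loc_measures_on I"
  using assms emeasure_smooth_finite
  by (simp add: contraction_def restrict_finite_borel_measure_in_loc_measures_on)

lemma contraction_in_measures_on:
  assumes "m \<in> measures_on I" "\<epsilon> \<ge> 0"
  shows "contraction (m, \<epsilon>) \<in> measures_on I"
  using assms contraction_in_loc_measures_on[of m \<epsilon>]
  by (cases "\<epsilon> = 0") (auto simp: contraction_def loc_measures_on_def)

lemma contraction_0 [simp]: "contraction (m, 0) = m"
  by (simp add: contraction_def)

lemma contraction_1: "contraction (m, 1) = null_measure (restrict_space borel I)"
proof (rule measure_eqI)
  show "sets (contraction (m, 1)) = sets (null_measure (restrict_space borel I))"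
    by (simp add: contraction_def sets_restrict_space)
next
  fix A assume "A \<in> sets (contraction (m, 1))"
  then have "A \<subseteq> I" "A \<in> sets borel"
    using open_I by (auto simp: contraction_def sets_restrict_space_iff)
  moreover have "smooth_density m 1 = (\<lambda>_. 0)"
    by (simp add: smooth_density_def fun_eq_iff)
  ultimately show "emeasure (contraction (m, 1)) A = emeasure (null_measure (restrict_space borel I)) A"
    by (simp add: emeasure_contraction smooth_def emeasure_density)
qed

lemma theta_tendsto_contraction_pos:
  assumes conv: "theta_tendsto \<mu> m" "m \<in> measures_on I" "\<And>n. \<mu> n \<in> measures_on I"
    and e: "e \<longlonglongrightarrow> \<epsilon>" "0 < \<epsilon>"
  shows "theta_tendsto (\<lambda>n. contraction (\<mu> n, e n)) (contraction (m, \<epsilon>))"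
proof -
  have lim: "(\<lambda>n. emeasure (contraction (\<mu> n, e n)) A) \<longlonglongrightarrow> emeasure (contraction (m, \<epsilon>)) A"
    if A: "A \<subseteq> I" "A \<in> sets borel" for A
  proof -
    have "\<forall>\<^sub>F n in sequentially. 0 < e n"
      using order_tendstoD(1)[OF e(1,2)] .
    then have "\<forall>\<^sub>F n in sequentially. emeasure (smooth (\<mu> n) (e n)) A = emeasure (contraction (\<mu> n, e n)) A"
      by eventually_elim (use A in \<open>simp add: emeasure_contraction\<close>)
    with emeasure_smooth_tendsto[OF conv e A(2)] show ?thesis
      using e A by (auto simp: emeasure_contraction elim: Lim_transform_eventually)
  qed
  show ?thesis
    unfolding theta_tendsto_def
    using order_tendstoD[OF lim] Ioo_subset Icc_subset by auto
qed

lemma theta_tendsto_contraction_0: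
  assumes conv: "theta_tendsto \<mu> m" "m \<in> measures_on I" "\<And>n. \<mu> n \<in> measures_on I"
    and e: "e \<longlonglongrightarrow> 0" "\<And>n. 0 \<le> e n" "\<And>n. e n \<le> 1"
  shows "theta_tendsto (\<lambda>n. contraction (\<mu> n, e n)) m"
  unfolding theta_tendsto_def
proof (intro conjI ballI impI allI)
  have small: "\<forall>\<^sub>F n in sequentially. e n < d" if "d > 0" for d
    using order_tendstoD(2)[OF e(1) that] .
  fix a b assume I: "a \<in> I \<inter> \<rat>" "b \<in> I \<inter> \<rat>"
  { fix c assume ab: "a < b" and c: "c < emeasure m {a<..<b}"
    then obtain p q where pq: "a < p" "p < q" "q < b" "c < emeasure m {p<..<q}"
      using less_emeasure_Ioo_imp_rational[OF conv(2)] I by blast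
    \<comment> \<open>A finite level strictly above \<open>c\<close>, as \<open>emeasure m {p<..<q}\<close> may be infinite and the factor
      \<open>1 - e n\<close> loses mass.\<close>
    obtain r :: rat where r: "c < real_of_rat r" "real_of_rat r < emeasure m {p<..<q}"
      using ennreal_rat_dense[OF pq(4)] by blast
    define d where "d = real_of_rat r"
    have d: "c < ennreal d" "ennreal d < emeasure m {p<..<q}"
      using r by (auto simp: d_def)
    have "d > 0"
      using d(1) by (cases "d > 0") (auto simp: ennreal_neg)
    have ab_sub: "{a..b} \<subseteq> I"
      using I by (intro Icc_subset) auto
    have pqI: "p \<in> I" "q \<in> I"
      using ab_sub pq by (auto intro!: subsetD[OF ab_sub])
    have "\<forall>\<^sub>F n in sequentially. ennreal d < emeasure (\<mu> n) {p<..<q}"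
      using theta_tendsto_Ioo[OF conv tendsto_const tendsto_const pqI d(2)] .
    moreover have "(\<lambda>n. ennreal ((1 - e n) * d)) \<longlonglongrightarrow> ennreal ((1 - 0) * d)"
      by (intro tendsto_intros e tendsto_ennrealI)
    then have "\<forall>\<^sub>F n in sequentially. c < ennreal ((1 - e n) * d)"
      using d(1) by (intro order_tendstoD) auto
    moreover have "\<forall>\<^sub>F n in sequentially. e n < 1 / d"
      using \<open>d > 0\<close> by (intro small) auto
    moreover have "\<forall>\<^sub>F n in sequentially. e n < 1 / (1 + \<bar>a\<bar> + \<bar>b\<bar>)"
      by (intro small) auto
    moreover have "\<forall>\<^sub>F n in sequentially. e n < (p - a) / 2" "\<forall>\<^sub>F n in sequentially. e n < (b - q) / 2"
      using small[of "(p - a) / 2"] small[of "(b - q) / 2"] pq by auto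
    ultimately show "\<forall>\<^sub>F n in sequentially. c < emeasure (contraction (\<mu> n, e n)) {a<..<b}"
    proof eventually_elim
      case (elim n)
      show ?case
      proof (cases "e n = 0")
        case True
        have "c < ennreal d" by (rule d(1))
        also have "\<dots> < emeasure (\<mu> n) {p<..<q}"
          by (rule elim)
        also have "\<dots> \<le> emeasure (\<mu> n) {a<..<b}"
          using pq ab_sub by (intro emeasure_mono_I[OF conv(3)]) auto
        finally show ?thesis
          using True by simp
      next
        case False
        then have "e n > 0"
          using e(2)[of n] by simp
        have ends: "a + 2 * e n < p" "q + 2 * e n < b"
          using elim(5,6) by simp_all
        have core: "{p - e n<..<q + e n} \<subseteq> core (e n)"
        proof
          fix x assume x: "x \<in> {p - e n<..<q + e n}"
          have x': "p - e n < x" "x < q + e n"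
            using x by simp_all
          have "x - e n \<in> {a..b}" "x + e n \<in> {a..b}" "\<bar>x\<bar> < 1 + \<bar>a\<bar> + \<bar>b\<bar>"
            using x' ends \<open>e n > 0\<close> unfolding atLeastAtMost_iff by linarith+
          moreover have "1 + \<bar>a\<bar> + \<bar>b\<bar> < 1 / e n"
            using elim(4) \<open>e n > 0\<close> by (simp add: pos_less_divide_eq mult.commute)
          ultimately show "x \<in> core (e n)"
            using ab_sub by (auto simp: core_def)
        qed
        have "d \<le> 1 / e n"
          using elim(3) \<open>e n > 0\<close> \<open>d > 0\<close> by (simp add: field_simps)
        have "c < ennreal ((1 - e n) * d)"
          by (rule elim)
        also have "\<dots> = ennreal (1 - e n) * ennreal d"
          using e(3)[of n] \<open>d > 0\<close> by (simp add: ennreal_mult)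
        also have "\<dots> \<le> ennreal (1 - e n) * min (emeasure (\<mu> n) {p<..<q}) (ennreal (1 / e n))"
          using elim(1) \<open>d \<le> 1 / e n\<close> by (intro mult_left_mono) (auto intro: ennreal_leI)
        also have "\<dots> \<le> emeasure (smooth (\<mu> n) (e n)) {p - e n<..<q + e n}"
          using emeasure_smooth_ge[OF conv(3) \<open>e n > 0\<close> e(3) core] .
        also have "\<dots> \<le> emeasure (smooth (\<mu> n) (e n)) {a<..<b}"
          using ends \<open>e n > 0\<close> by (intro emeasure_mono) auto
        finally show ?thesis
          using False ab_sub by (subst emeasure_contraction) auto
      qed
    qed }
  { fix c assume ab: "a \<le> b" and c: "emeasure m {a..b} < c"
    then obtain p q where pq: "p \<in> I" "q \<in> I" "p < a" "b < q" "emeasure m {p..q} < c"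
      using emeasure_Icc_less_imp_rational[OF conv(2)] I by blast
    have pq_sub: "{p..q} \<subseteq> I"
      using pq by (intro Icc_subset) auto
    have "\<forall>\<^sub>F n in sequentially. emeasure (\<mu> n) {p..q} < c"
      using pq ab theta_tendsto_Icc[OF conv tendsto_const tendsto_const pq(1,2) _ pq(5)] by simp
    moreover have "\<forall>\<^sub>F n in sequentially. e n < a - p" "\<forall>\<^sub>F n in sequentially. e n < q - b"
      using pq by (auto intro!: small)
    ultimately show "\<forall>\<^sub>F n in sequentially. emeasure (contraction (\<mu> n, e n)) {a..b} < c"
    proof eventually_elim
      case (elim n)
      have ends: "a - e n \<in> {p..q}" "b + e n \<in> {p..q}"
        using elim ab e(2)[of n] pq by auto
      have "emeasure (contraction (\<mu> n, e n)) {a..b} \<le> emeasure (\<mu> n) {a - e n..b + e n}"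
      proof (cases "e n = 0")
        case False
        then have "e n > 0"
          using e(2)[of n] by simp
        have "emeasure (contraction (\<mu> n, e n)) {a..b} = emeasure (smooth (\<mu> n) (e n)) {a..b}"
          using False Icc_subset I by (intro emeasure_contraction) auto
        also have "\<dots> \<le> emeasure (\<mu> n) {a - e n..b + e n}"
          using ends pq_sub \<open>e n > 0\<close> by (intro emeasure_smooth_le[OF conv(3)]) auto
        finally show ?thesis .
      qed simp
      also have "\<dots> \<le> emeasure (\<mu> n) {p..q}"
        using ends pq_sub by (intro emeasure_mono_I[OF conv(3)]) auto
      also have "\<dots> < c"
        by (rule elim)
      finally show ?case .
    qed }
qed

section \<open>Continuity via sequences\<close>

lemma openin_theta_topology_Ioo:
  assumes "a \<in> I \<inter> \<rat>" "b \<in> I \<inter> \<rat>" "a < b"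
  shows "openin (theta_topology I) {m \<in> measures_on I. c < emeasure m {a<..<b}}"
  using interval_semicontinuous_theta_topology[of I] assms
  unfolding interval_semicontinuous_def lower_semicontinuous_map_def by simp

lemma openin_theta_topology_Icc:
  assumes "a \<in> I \<inter> \<rat>" "b \<in> I \<inter> \<rat>" "a \<le> b"
  shows "openin (theta_topology I) {m \<in> measures_on I. emeasure m {a..b} < c}"
  using interval_semicontinuous_theta_topology[of I] assms
  unfolding interval_semicontinuous_def upper_semicontinuous_map_def by simp

text \<open>
  It is enough to bound the measures of the intervals by rational constants, which leaves only
  countably many neighbourhoods.
\<close>

lemma countable_theta_neighbourhoods:
  assumes m: "m \<in> measures_on I"
  shows "\<exists>W :: nat \<Rightarrow> real measure set. (\<forall>k. openin (theta_topology I) (W k) \<and> m \<in> W k) \<and>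
    (\<forall>\<mu>. (\<forall>k. \<forall>\<^sub>F n in sequentially. \<mu> n \<in> W k) \<longrightarrow> theta_tendsto \<mu> m)"
proof -
  define L where "L = (\<lambda>(a::real, b::real, r::rat). {\<mu> \<in> measures_on I. ennreal (real_of_rat r) < emeasure \<mu> {a<..<b}})"
  define R where "R = (\<lambda>(a::real, b::real, r::rat). {\<mu> \<in> measures_on I. emeasure \<mu> {a..b} < ennreal (real_of_rat r)})"
  define T where "T = (I \<inter> \<rat>) \<times> (I \<inter> \<rat>) \<times> (UNIV :: rat set)"
  define F where "F = insert (measures_on I)
    (L ` {t \<in> T. fst t < fst (snd t) \<and> m \<in> L t} \<union> R ` {t \<in> T. fst t \<le> fst (snd t) \<and> m \<in> R t})"
  have "countable T"
    unfolding T_def by (intro countable_SIGMA) (auto intro: countable_rat)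
  then have F: "countable F" "F \<noteq> {}"
    unfolding F_def by (auto intro!: countable_image intro: countable_subset[of _ T])
  define W where "W = from_nat_into F"
  have W: "range W = F"
    unfolding W_def using F by (intro range_from_nat_into)
  show ?thesis
  proof (intro exI[of _ W] conjI allI impI)
    fix k
    have Wk: "W k \<in> F"
      using W by blast
    then show "m \<in> W k"
      using m by (auto simp: F_def)
    show "openin (theta_topology I) (W k)"
      using Wk openin_topspace[of "theta_topology I"] openin_theta_topology_Ioo openin_theta_topology_Icc
      by (auto simp: F_def L_def R_def T_def)
  next
    fix \<mu> :: "nat \<Rightarrow> real measure"
    assume "\<forall>k. \<forall>\<^sub>F n in sequentially. \<mu> n \<in> W k"
    then have ev: "\<forall>\<^sub>F n in sequentially. \<mu> n \<in> S" if "S \<in> F" for S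
      using that W by blast
    show "theta_tendsto \<mu> m"
      unfolding theta_tendsto_def
    proof (intro conjI ballI impI allI)
      fix a b c assume I: "a \<in> I \<inter> \<rat>" "b \<in> I \<inter> \<rat>" and "a < b" and c: "c < emeasure m {a<..<b}"
      obtain r :: rat where r: "c < real_of_rat r" "real_of_rat r < emeasure m {a<..<b}"
        using ennreal_rat_dense[OF c] by blast
      have "(a, b, r) \<in> {t \<in> T. fst t < fst (snd t) \<and> m \<in> L t}"
        using I \<open>a < b\<close> r m by (simp add: T_def L_def)
      then have "L (a, b, r) \<in> F"
        unfolding F_def by blast
      from ev[OF this] show "\<forall>\<^sub>F n in sequentially. c < emeasure (\<mu> n) {a<..<b}"
        by eventually_elim (use r(1) in \<open>auto simp: L_def\<close>)
    next
      fix a b c assume I: "a \<in> I \<inter> \<rat>" "b \<in> I \<inter> \<rat>" and "a \<le> b" and c: "emeasure m {a..b} < c"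
      obtain r :: rat where r: "emeasure m {a..b} < real_of_rat r" "real_of_rat r < c"
        using ennreal_rat_dense[OF c] by blast
      have "(a, b, r) \<in> {t \<in> T. fst t \<le> fst (snd t) \<and> m \<in> R t}"
        using I \<open>a \<le> b\<close> r m by (simp add: T_def R_def)
      then have "R (a, b, r) \<in> F"
        unfolding F_def by blast
      from ev[OF this] show "\<forall>\<^sub>F n in sequentially. emeasure (\<mu> n) {a..b} < c"
        by eventually_elim (use r(2) in \<open>auto simp: R_def\<close>)
    qed
  qed
qed

lemma openin_prod_theta_sequentially:
  fixes U :: "(real measure \<times> real) set"
  assumes U: "U \<subseteq> measures_on I \<times> {0..1}"
    and seq: "\<And>\<mu> m e \<epsilon>. theta_tendsto \<mu> m \<Longrightarrow> m \<in> measures_on I \<Longrightarrow> (\<And>n. \<mu> n \<in> measures_on I) \<Longrightarrow>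
      e \<longlonglongrightarrow> \<epsilon> \<Longrightarrow> \<epsilon> \<in> {0..1} \<Longrightarrow> (\<And>n. e n \<in> {0..1}) \<Longrightarrow> (m, \<epsilon>) \<in> U \<Longrightarrow>
      \<forall>\<^sub>F n in sequentially. (\<mu> n, e n) \<in> U"
  shows "openin (prod_topology (theta_topology I) (top_of_set {0..1})) U" (is "openin ?X U")
proof (subst openin_subopen, intro ballI)
  fix x assume x: "x \<in> U"
  obtain m \<epsilon> where x_eq: "x = (m, \<epsilon>)"
    by (cases x)
  have m: "m \<in> measures_on I" and eps: "\<epsilon> \<in> {0..1}"
    using subsetD[OF U x] by (simp_all add: x_eq)
  from countable_theta_neighbourhoods[OF m] obtain W :: "nat \<Rightarrow> real measure set"
    where Wk: "\<forall>k. openin (theta_topology I) (W k) \<and> m \<in> W k"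
      and conv: "\<forall>\<mu>. (\<forall>k. \<forall>\<^sub>F n in sequentially. \<mu> n \<in> W k) \<longrightarrow> theta_tendsto \<mu> m"
    by (elim exE conjE)
  then have W: "openin (theta_topology I) (W k)" "m \<in> W k" for k
    by simp_all
  define V where "V n = (\<Inter>k\<le>n. W k) \<times> ({0..1} \<inter> ball \<epsilon> (1 / Suc n))" for n
  have V: "openin ?X (V n)" "x \<in> V n" for n
  proof -
    have "openin (theta_topology I) (\<Inter>k\<le>n. W k)"
      using W(1) by (intro openin_Inter) auto
    moreover have "openin (top_of_set {0..1}) ({0..1} \<inter> ball \<epsilon> (1 / Suc n))"
      by (intro openin_open_Int) simp
    ultimately show "openin ?X (V n)"
      unfolding V_def by (simp add: openin_prod_Times_iff)
    show "x \<in> V n"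
      using W(2) eps by (simp add: V_def x_eq)
  qed
  show "\<exists>T. openin ?X T \<and> x \<in> T \<and> T \<subseteq> U"
  proof (rule ccontr)
    assume "\<nexists>T. openin ?X T \<and> x \<in> T \<and> T \<subseteq> U"
    then have "\<exists>y. y \<in> V n \<and> y \<notin> U" for n
      using V[of n] by blast
    then obtain y where y: "\<And>n. y n \<in> V n" "\<And>n. y n \<notin> U"
      using choice[of "\<lambda>n y. y \<in> V n \<and> y \<notin> U"] by blast
    define \<mu> where "\<mu> n = fst (y n)" for n
    define e where "e n = snd (y n)" for n
    have mu: "\<mu> n \<in> W k" if "k \<le> n" for k n
      using y(1)[of n] that by (auto simp: V_def \<mu>_def)
    have e: "e n \<in> {0..1}" "dist (e n) \<epsilon> < 1 / Suc n" for n
      using y(1)[of n] by (auto simp: V_def e_def dist_commute)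
    have "theta_tendsto \<mu> m"
      using mu by (intro conv[rule_format]) (auto simp: eventually_sequentially)
    moreover have "\<mu> n \<in> measures_on I" for n
      using mu[of 0 n] openin_subset[OF W(1)[of 0]] by auto
    moreover have "e \<longlonglongrightarrow> \<epsilon>"
    proof (rule metric_tendsto_imp_tendsto)
      show "(\<lambda>n. 1 / real (Suc n)) \<longlonglongrightarrow> 0"
        by (rule LIMSEQ_Suc) (rule lim_1_over_n)
      show "\<forall>\<^sub>F n in sequentially. dist (e n) \<epsilon> \<le> dist (1 / real (Suc n)) 0"
        using e(2) by (auto intro!: always_eventually less_imp_le)
    qed
    ultimately have "\<forall>\<^sub>F n in sequentially. (\<mu> n, e n) \<in> U"
      using seq[of \<mu> m e \<epsilon>] m eps e(1) x by (simp add: x_eq)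
    then show False
      using y(2) by (auto simp: \<mu>_def e_def dest: eventually_happens)
  qed
qed

lemma continuous_map_into_theta:
  assumes f: "f \<in> topspace X \<rightarrow> measures_on I"
    and Ioo: "\<And>a b c. a \<in> I \<inter> \<rat> \<Longrightarrow> b \<in> I \<inter> \<rat> \<Longrightarrow> a < b \<Longrightarrow>
      openin X {x \<in> topspace X. c < emeasure (f x) {a<..<b}}"
    and Icc: "\<And>a b c. a \<in> I \<inter> \<rat> \<Longrightarrow> b \<in> I \<inter> \<rat> \<Longrightarrow> a \<le> b \<Longrightarrow>
      openin X {x \<in> topspace X. emeasure (f x) {a..b} < c}"
  shows "continuous_map X (theta_topology I) f"
proof -
  have eq: "f -` {m \<in> measures_on I. P m} \<inter> topspace X = {x \<in> topspace X. P (f x)}" for P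
    using f by auto
  have top: "f -` measures_on I \<inter> topspace X = topspace X"
    using f by auto
  show ?thesis
    unfolding theta_topology_def
  proof (rule continuous_on_generated_topo)
    fix U
    assume "U \<in> {measures_on I} \<union>
      {{m \<in> measures_on I. c < emeasure m {a<..<b}} | a b c. a \<in> I \<inter> \<rat> \<and> b \<in> I \<inter> \<rat> \<and> a < b} \<union>
      {{m \<in> measures_on I. emeasure m {a..b} < c} | a b c. a \<in> I \<inter> \<rat> \<and> b \<in> I \<inter> \<rat> \<and> a \<le> b}"
    then consider "U = measures_on I"
      | a b c where "U = {m \<in> measures_on I. c < emeasure m {a<..<b}}" "a \<in> I \<inter> \<rat>" "b \<in> I \<inter> \<rat>" "a < b"
      | a b c where "U = {m \<in> measures_on I. emeasure m {a..b} < c}" "a \<in> I \<inter> \<rat>" "b \<in> I \<inter> \<rat>" "a \<le> b"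
      by blast
    then show "openin X (f -` U \<inter> topspace X)"
    proof cases
      case 1
      then show ?thesis
        by (simp only: top openin_topspace)
    next
      case 2
      then show ?thesis
        by (simp only: eq Ioo)
    next
      case 3
      then show ?thesis
        by (simp only: eq Icc)
    qed
  qed (use f in blast)
qed

lemma continuous_map_contraction:
  "continuous_map (prod_topology (theta_topology I) (top_of_set {0..1})) (theta_topology I) contraction"
proof (rule continuous_map_into_theta)
  have seq: "theta_tendsto (\<lambda>n. contraction (\<mu> n, e n)) (contraction (m, \<epsilon>))"
    if "theta_tendsto \<mu> m" "m \<in> measures_on I" "\<And>n. \<mu> n \<in> measures_on I"
      "e \<longlonglongrightarrow> \<epsilon>" "\<epsilon> \<in> {0..1}" "\<And>n. e n \<in> {0..1}" for \<mu> m e \<epsilon>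
  proof (cases "\<epsilon> = 0")
    case True
    then show ?thesis
      using that theta_tendsto_contraction_0[of \<mu> m e] by simp
  next
    case False
    then show ?thesis
      using that by (intro theta_tendsto_contraction_pos) auto
  qed
  show "contraction \<in> topspace (prod_topology (theta_topology I) (top_of_set {0..1})) \<rightarrow> measures_on I"
    by (auto intro: contraction_in_measures_on)
  fix a b c assume I: "a \<in> I \<inter> \<rat>" "b \<in> I \<inter> \<rat>"
  { assume "a < b"
    show "openin (prod_topology (theta_topology I) (top_of_set {0..1}))
        {x \<in> topspace (prod_topology (theta_topology I) (top_of_set {0..1})).
          c < emeasure (contraction x) {a<..<b}}"
    proof (rule openin_prod_theta_sequentially, goal_cases)
      case (2 \<mu> m e \<epsilon>)
      then have "\<forall>\<^sub>F n in sequentially. c < emeasure (contraction (\<mu> n, e n)) {a<..<b}"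
        using seq[OF 2(1-6)] I \<open>a < b\<close> unfolding theta_tendsto_def by simp
      then show ?case
        using 2 by simp
    qed auto }
  { assume "a \<le> b"
    show "openin (prod_topology (theta_topology I) (top_of_set {0..1}))
        {x \<in> topspace (prod_topology (theta_topology I) (top_of_set {0..1})).
          emeasure (contraction x) {a..b} < c}"
    proof (rule openin_prod_theta_sequentially, goal_cases)
      case (2 \<mu> m e \<epsilon>)
      then have "\<forall>\<^sub>F n in sequentially. emeasure (contraction (\<mu> n, e n)) {a..b} < c"
        using seq[OF 2(1-6)] I \<open>a \<le> b\<close> unfolding theta_tendsto_def by simp
      then show ?case
        using 2 by simp
    qed auto }
qed

end

theorem proposition6p6:
  fixes \<alpha> \<beta> :: ereal and I :: "real set"
  assumes "\<alpha> < \<beta>" and "I = einterval \<alpha> \<beta>"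
  shows "\<exists>H :: real measure \<times> real \<Rightarrow> real measure.
    continuous_map (prod_topology (theta_topology I) (top_of_set {0..1})) (theta_topology I) H \<and>
    (\<forall>m \<in> measures_on I. H (m, 0) = m \<and> H (m, 1) = null_measure (restrict_space borel I)) \<and>
    (\<forall>\<epsilon> \<in> {0<..1}. \<forall>m \<in> measures_on I. H (m, \<epsilon>) \<in> loc_measures_on I)"
proof -
  interpret open_interval I \<alpha> \<beta>
    by unfold_locales (rule assms(2))
  show ?thesis
    using continuous_map_contraction contraction_0 contraction_1 contraction_in_loc_measures_on
    by (intro exI[of _ contraction]) auto
qed

end
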